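(* Let $a>0$ be the absolute constant such that for every $0<\eta\le1/2$ and every $m\le\exp(a\eta^2 d_k)$ there exist unit vectors $u_1,\dots,u_m\in\mathbb{R}^{d_k}$ with $\langle u_i,u_h\rangle\le\eta$ for all $i\ne h$. Fix dimensions $d,d_k>1$, $\rho\ge2$, let $L=e^\rho$, and let $0<\varepsilon\le\varepsilon_0/\sqrt d$ for a sufficiently small absolute constant $\varepsilon_0$. Suppose there is a (possibly randomized) coreset algorithm that, for any input collection of pairs $(K,V)$ with keys $k_i\in\mathbb{R}^{d_k}$, values $v_i\in\mathbb{R}^d$, $\|k_i\|_2,\|v_i\|_2\le1$, produces a sub-collection $(K',V')$ of the input pairs of size $S$ such that for any $q\in\mathbb{R}^{d_k}$ with $\|q\|_2\le\rho$, with constant probability, \[ \|\mathrm{Attn}(q,K,V)-\mathrm{Attn}(q,K',V')\|_2\le\varepsilon. \] Then \[ S=\Omega\!\left(d\cdot\min\{L/(\varepsilon\sqrt d),\;L^2,\;\exp(a d_k/\log^2L)\}\right). \]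
   Context: $\mathrm{Attn}(q,K,V)=\dfrac{\sum_i e^{q^Tk_i}v_i}{\sum_i e^{q^Tk_i}}$, sums over the key-value pairs in the collection. *)

theory Defs
  imports "HOL-Probability.Probability"
begin

text \<open>Vectors of R^n are represented as functions nat => real vanishing outside {..<n}.\<close>

definition vecs :: "nat \<Rightarrow> (nat \<Rightarrow> real) set" where
  "vecs n = {x. \<forall>i\<ge>n. x i = 0}"

definition ip :: "nat \<Rightarrow> (nat \<Rightarrow> real) \<Rightarrow> (nat \<Rightarrow> real) \<Rightarrow> real" where
  "ip n x y = (\<Sum>i<n. x i * y i)"

definition nrm :: "nat \<Rightarrow> (nat \<Rightarrow> real) \<Rightarrow> real" where
  "nrm n x = sqrt (ip n x x)"

definition attn_sub :: "nat \<Rightarrow> (nat \<Rightarrow> real) \<Rightarrow> ((nat \<Rightarrow> real) \<times> (nat \<Rightarrow> real)) list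
    \<Rightarrow> nat set \<Rightarrow> (nat \<Rightarrow> real)" where
  "attn_sub dk q ps I = (\<lambda>j. (\<Sum>i\<in>I. exp (ip dk q (fst (ps ! i))) * snd (ps ! i) j)
                            / (\<Sum>i\<in>I. exp (ip dk q (fst (ps ! i)))))"

definition attn :: "nat \<Rightarrow> (nat \<Rightarrow> real) \<Rightarrow> ((nat \<Rightarrow> real) \<times> (nat \<Rightarrow> real)) list
    \<Rightarrow> (nat \<Rightarrow> real)" where
  "attn dk q ps = attn_sub dk q ps {..<length ps}"

definition packing_const :: "real \<Rightarrow> bool" where
  "packing_const a \<longleftrightarrow> a > 0 \<and>
     (\<forall>(dk::nat) (\<eta>::real) (m::nat). dk \<ge> 1 \<and> 0 < \<eta> \<and> \<eta> \<le> 1/2 \<and> real m \<le> exp (a * \<eta>^2 * real dk) \<longrightarrow>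
        (\<exists>u :: nat \<Rightarrow> nat \<Rightarrow> real.
            (\<forall>i<m. u i \<in> vecs dk \<and> nrm dk (u i) = 1) \<and>
            (\<forall>i<m. \<forall>h<m. i \<noteq> h \<longrightarrow> ip dk (u i) (u h) \<le> \<eta>)))"

definition valid_input :: "nat \<Rightarrow> nat \<Rightarrow> ((nat \<Rightarrow> real) \<times> (nat \<Rightarrow> real)) list \<Rightarrow> bool" where
  "valid_input dk d ps \<longleftrightarrow> (\<forall>(k, v) \<in> set ps. k \<in> vecs dk \<and> nrm dk k \<le> 1 \<and> v \<in> vecs d \<and> nrm d v \<le> 1)"

definition coreset_alg :: "nat \<Rightarrow> nat \<Rightarrow> real \<Rightarrow> real \<Rightarrow> real \<Rightarrow> nat
    \<Rightarrow> (((nat \<Rightarrow> real) \<times> (nat \<Rightarrow> real)) list \<Rightarrow> nat set pmf) \<Rightarrow> bool" where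
  "coreset_alg dk d \<rho> \<epsilon> p S A \<longleftrightarrow>
     (\<forall>ps. valid_input dk d ps \<longrightarrow>
        (\<forall>I \<in> set_pmf (A ps). I \<subseteq> {..<length ps} \<and> card I \<le> S) \<and>
        (\<forall>q \<in> vecs dk. nrm dk q \<le> \<rho> \<longrightarrow>
            measure_pmf.prob (A ps)
              {I. nrm d (\<lambda>j. attn dk q ps j - attn_sub dk q ps I j) \<le> \<epsilon>} \<ge> p))"

end

theory Submission
  imports Defs
begin

text \<open>
  Take \<open>m\<close> nearly orthogonal unit keys \<open>u\<^sub>h\<close> with inner products at most \<open>1/\<rho>\<close> and attach to each key
  the \<open>d\<close> values \<open>x\<^sub>h\<^sub>j e\<^sub>j\<close>, where the \<open>x\<^sub>h\<^sub>j\<close> run through a symmetric grid of \<open>N\<close> points of \<open>[-1, 1]\<close>.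
  The query \<open>\<rho> u\<^sub>h\<close> gives weight \<open>L\<close> to the pairs of key \<open>h\<close> and weight at most \<open>e\<close> to all others, so up
  to normalisation its attention has \<open>j\<close>-th coordinate \<open>L x\<^sub>h\<^sub>j\<close> plus noise. The second moment
  of the noise over all grid assignments is at most \<open>e\<^sup>2 (m - 1)\<close>, negligible against \<open>L\<^sup>2\<close> if
  \<open>m\<close> is a small multiple of \<open>L\<^sup>2\<close>; the accuracy \<open>\<epsilon>\<close> resolves the grid if \<open>m\<close> is a small multiple of
  \<open>L / (\<epsilon> \<surd>d)\<close>.

  Averaging over the randomness of the algorithm, some output \<open>I\<close> answers at least \<open>p m\<close> of
  the queries, and hence \<open>I\<close> together with the values on \<open>I\<close> determines \<open>x\<close> on a set \<open>R\<close> of at least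
  \<open>p m d / 2\<close> positions. If \<open>|I| < p m d / 4\<close>, then at most \<open>4\<^sup>n N\<^sup>k\<close> assignments arise, with \<open>n = m d\<close>
  and \<open>k = n - p n / 4\<close>, which is less than half of all \<open>N\<^sup>n\<close> as soon as \<open>N\<close> is large in
  terms of \<open>p\<close>. A grid is used instead of signs because for small \<open>d\<close> signs could be guessed with
  probability above \<open>p\<close>.
\<close>

section \<open>Averaging over outcomes, and counting over key-coordinate positions\<close>

text \<open>By linearity the expected number of events that occur is at least
  \<open>p * card H\<close>, so some outcome in the support attains this. It turns a guarantee for
  each single query into one fixed output that answers many queries at once.\<close>

lemma pmf_exists_outcome_many_events:
  fixes P :: "'a pmf"
  assumes fin: "finite (set_pmf P)" and H: "finite H"
    and p: "\<And>h. h \<in> H \<Longrightarrow> p \<le> measure_pmf.prob P {x. Q h x}"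
  shows "\<exists>x\<in>set_pmf P. p * real (card H) \<le> real (card {h\<in>H. Q h x})"
proof (rule ccontr)
  let ?F = "set_pmf P"
  assume "\<not> ?thesis"
  then have lt: "real (card {h\<in>H. Q h x}) < p * real (card H)" if "x \<in> ?F" for x
    using that by force
  have prob: "measure_pmf.prob P {x. Q h x} = (\<Sum>x\<in>?F. pmf P x * of_bool (Q h x))" for h
  proof -
    have "measure_pmf.prob P {x. Q h x} = measure_pmf.prob P ({x. Q h x} \<inter> ?F)"
      by (simp add: measure_Int_set_pmf)
    also have "\<dots> = sum (pmf P) ({x. Q h x} \<inter> ?F)"
      by (rule measure_measure_pmf_finite) (use fin in auto)
    also have "\<dots> = (\<Sum>x\<in>?F. pmf P x * of_bool (Q h x))"
      by (rule sum.mono_neutral_cong_left) (use fin in auto)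
    finally show ?thesis .
  qed
  have "p * real (card H) \<le> (\<Sum>h\<in>H. measure_pmf.prob P {x. Q h x})"
    using sum_mono[of H "\<lambda>_. p" "\<lambda>h. measure_pmf.prob P {x. Q h x}"] p by (simp add: mult.commute)
  also have "\<dots> = (\<Sum>x\<in>?F. pmf P x * (\<Sum>h\<in>H. of_bool (Q h x)))"
    unfolding prob by (subst sum.swap) (simp add: sum_distrib_left)
  also have "\<dots> = (\<Sum>x\<in>?F. pmf P x * real (card {h\<in>H. Q h x}))"
    using H by (simp add: Int_def)
  also have "\<dots> < (\<Sum>x\<in>?F. pmf P x * (p * real (card H)))"
    by (rule sum_strict_mono) (use fin lt in \<open>auto simp: set_pmf_not_empty pmf_positive\<close>)
  also have "\<dots> = p * real (card H)"
    using sum_pmf_eq_1[OF fin] by (simp flip: sum_distrib_right)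
  finally show False by simp
qed

lemma sum_div_mod:
  fixes F :: "nat \<Rightarrow> nat \<Rightarrow> 'a::comm_monoid_add" and d m :: nat
  assumes "d > 0"
  shows "(\<Sum>i<m * d. F (i div d) (i mod d)) = (\<Sum>h<m. \<Sum>j<d. F h j)"
proof -
  have *: "j + h * d < m * d" if "h < m" "j < d" for h j
  proof -
    have "j + h * d < Suc h * d" using that by simp
    also have "\<dots> \<le> m * d" using that by (intro mult_right_mono) auto
    finally show ?thesis .
  qed
  show ?thesis
    unfolding sum.cartesian_product
    by (rule sum.reindex_bij_witness[where i = "\<lambda>(h, j). j + h * d" and j = "\<lambda>i. (i div d, i mod d)"])
       (use assms * in \<open>auto simp: less_mult_imp_div_less\<close>)
qed

lemma card_div_mod:
  fixes d m :: nat
  assumes "d > 0"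
  shows "card {i. i < m * d \<and> P (i div d) (i mod d)} = (\<Sum>h<m. card {j. j < d \<and> P h j})"
proof -
  have "card {i. i < m * d \<and> P (i div d) (i mod d)}
      = (\<Sum>i<m * d. of_bool (P (i div d) (i mod d)))"
    by (subst sum_of_bool_eq) (auto intro!: arg_cong[where f = card])
  also have "\<dots> = (\<Sum>h<m. \<Sum>j<d. of_bool (P h j))"
    by (rule sum_div_mod[OF assms])
  also have "\<dots> = (\<Sum>h<m. card {j. j < d \<and> P h j})"
    by (subst sum_of_bool_eq) (auto intro!: sum.cong arg_cong[where f = card])
  finally show ?thesis .
qed

text \<open>Chebyshev's inequality for counting measure, multiplied out to avoid dividing by
  \<open>t\<close>.\<close>

lemma card_exceeding_le:
  fixes z :: "'a \<Rightarrow> real"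
  assumes "finite X" and "0 \<le> t" and "(\<Sum>i\<in>X. (z i)\<^sup>2) \<le> B"
  shows "real (card {i\<in>X. t < \<bar>z i\<bar>}) * t\<^sup>2 \<le> B"
proof -
  have "real (card {i\<in>X. t < \<bar>z i\<bar>}) * t\<^sup>2 = (\<Sum>i\<in>{i\<in>X. t < \<bar>z i\<bar>}. t\<^sup>2)"
    by simp
  also have "\<dots> \<le> (\<Sum>i\<in>{i\<in>X. t < \<bar>z i\<bar>}. (z i)\<^sup>2)"
    using assms(2) by (intro sum_mono) (auto simp flip: abs_le_square_iff)
  also have "\<dots> \<le> (\<Sum>i\<in>X. (z i)\<^sup>2)"
    using assms(1) by (intro sum_mono2) auto
  finally show ?thesis using assms(3) by simp
qed

section \<open>Symmetric grid values: separation and second moment\<close>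

text \<open>The midpoints of the \<open>N\<close> cells of length 2/N that tile [-1, 1].\<close>

definition grid :: "nat \<Rightarrow> nat \<Rightarrow> real" where
  "grid N k = (2 * real k + 1 - real N) / real N"

lemma abs_grid_le_1: "k < N \<Longrightarrow> \<bar>grid N k\<bar> \<le> 1"
  by (simp add: grid_def field_simps abs_le_iff)

lemma grid_reflect: "k < N \<Longrightarrow> grid N (N - 1 - k) = - grid N k"
  by (simp add: grid_def field_simps of_nat_diff)

text \<open>Distinct grid points are at least 2/N apart, whereas two points this close to
  \<open>y\<close> differ by at most 1/N.\<close>

lemma grid_eqI:
  assumes "0 < N" and "\<bar>grid N k - y\<bar> \<le> 1 / (2 * real N)" and "\<bar>grid N l - y\<bar> \<le> 1 / (2 * real N)"
  shows "k = l"
proof -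
  have "\<bar>grid N k - grid N l\<bar> \<le> 1 / real N"
  proof -
    have "\<bar>grid N k - grid N l\<bar> \<le> 1 / (2 * real N) + 1 / (2 * real N)"
      using assms(2,3) by linarith
    then show ?thesis by simp
  qed
  moreover have "grid N k - grid N l = 2 * (real k - real l) / real N"
    using assms by (simp add: grid_def field_simps)
  ultimately have "\<bar>2 * (real k - real l)\<bar> \<le> 1"
    using assms(1) by (simp add: abs_divide field_simps)
  then show ?thesis by (cases k l rule: linorder_cases) auto
qed

text \<open>Reflecting the coordinate \<open>i\<close> is an involution of the assignments that
  flips the sign of the first factor and keeps the second, so the sum equals its own
  negative.\<close>

lemma sum_grid_mult_eq_0:
  assumes "i \<in> X" and "i \<noteq> l"
  shows "(\<Sum>f\<in>PiE X (\<lambda>_. {..<N}). grid N (f i) * grid N (f l)) = 0"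
proof -
  let ?S = "\<Sum>f\<in>PiE X (\<lambda>_. {..<N}). grid N (f i) * grid N (f l)"
  have "?S = (\<Sum>f\<in>PiE X (\<lambda>_. {..<N}). - (grid N (f i) * grid N (f l)))"
  proof (rule sum.reindex_bij_witness[where i = "\<lambda>f. f(i := N - 1 - f i)" and j = "\<lambda>f. f(i := N - 1 - f i)"])
    fix f assume f: "f \<in> PiE X (\<lambda>_. {..<N})"
    then have fi: "f i < N" using assms by auto
    show "(f(i := N - 1 - f i))(i := N - 1 - (f(i := N - 1 - f i)) i) = f"
      using fi by auto
    show "f(i := N - 1 - f i) \<in> PiE X (\<lambda>_. {..<N})"
      using f fi assms by (auto simp: PiE_iff extensional_def)
    show "- (grid N ((f(i := N - 1 - f i)) i) * grid N ((f(i := N - 1 - f i)) l))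
        = grid N (f i) * grid N (f l)"
      using grid_reflect[OF fi] by (simp add: assms(2)[symmetric])
  qed (use assms in \<open>auto simp: PiE_iff extensional_def\<close>)
  then show ?thesis by (simp add: sum_negf)
qed

text \<open>Expand the square: the mixed terms cancel by symmetry, and each diagonal term is at most
  \<open>C\<^sup>2\<close> per assignment.\<close>

lemma grid_second_moment:
  fixes c :: "'a \<Rightarrow> real"
  assumes "finite X" and "J \<subseteq> X" and "\<And>i. i \<in> J \<Longrightarrow> \<bar>c i\<bar> \<le> C"
  shows "(\<Sum>f\<in>PiE X (\<lambda>_. {..<N}). (\<Sum>i\<in>J. c i * grid N (f i))\<^sup>2)
      \<le> real (card (PiE X (\<lambda>_. {..<N}))) * (real (card J) * C\<^sup>2)"
proof -
  let ?P = "PiE X (\<lambda>_. {..<N})"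
  have J: "finite J" using assms finite_subset by blast
  have "(\<Sum>f\<in>?P. (\<Sum>i\<in>J. c i * grid N (f i))\<^sup>2)
      = (\<Sum>i\<in>J. \<Sum>l\<in>J. c i * c l * (\<Sum>f\<in>?P. grid N (f i) * grid N (f l)))"
  proof -
    have "(\<Sum>f\<in>?P. (\<Sum>i\<in>J. c i * grid N (f i))\<^sup>2)
        = (\<Sum>f\<in>?P. \<Sum>i\<in>J. \<Sum>l\<in>J. c i * c l * (grid N (f i) * grid N (f l)))"
      by (simp add: power2_eq_square sum_product ac_simps)
    also have "\<dots> = (\<Sum>i\<in>J. \<Sum>f\<in>?P. \<Sum>l\<in>J. c i * c l * (grid N (f i) * grid N (f l)))"
      by (rule sum.swap)
    also have "\<dots> = (\<Sum>i\<in>J. \<Sum>l\<in>J. \<Sum>f\<in>?P. c i * c l * (grid N (f i) * grid N (f l)))"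
      by (intro sum.cong refl sum.swap)
    finally show ?thesis by (simp add: sum_distrib_left)
  qed
  also have "\<dots> = (\<Sum>i\<in>J. \<Sum>l\<in>J. if l = i then (c i)\<^sup>2 * (\<Sum>f\<in>?P. (grid N (f i))\<^sup>2) else 0)"
    using assms(2) by (intro sum.cong refl) (auto simp: power2_eq_square sum_grid_mult_eq_0)
  also have "\<dots> = (\<Sum>i\<in>J. (c i)\<^sup>2 * (\<Sum>f\<in>?P. (grid N (f i))\<^sup>2))"
    using J by simp
  also have "\<dots> \<le> (\<Sum>i\<in>J. C\<^sup>2 * real (card ?P))"
  proof (intro sum_mono mult_mono)
    fix i assume i: "i \<in> J"
    show "(c i)\<^sup>2 \<le> C\<^sup>2" using assms(3)[OF i] by (metis abs_ge_zero power2_abs power_mono)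
    have "(grid N (f i))\<^sup>2 \<le> 1" if "f \<in> ?P" for f
    proof -
      have "f i < N" using that i assms(2) by auto
      then show ?thesis using abs_grid_le_1 by (simp add: abs_square_le_1)
    qed
    then show "(\<Sum>f\<in>?P. (grid N (f i))\<^sup>2) \<le> real (card ?P)"
      using sum_mono[of ?P "\<lambda>f. (grid N (f i))\<^sup>2" "\<lambda>_. 1"] by simp
  qed (auto intro: sum_nonneg)
  finally show ?thesis by (simp add: ac_simps)
qed

section \<open>Markov's inequality and the count of decodable assignments\<close>

lemma half_le_card_below_twice_average:
  fixes w :: "'a \<Rightarrow> real"
  assumes "finite P" and "\<And>f. f \<in> P \<Longrightarrow> 0 \<le> w f" and "0 \<le> K"
    and "(\<Sum>f\<in>P. w f) \<le> real (card P) * K"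
  shows "real (card P) \<le> 2 * real (card {f\<in>P. w f \<le> 2 * K})"
proof -
  let ?T = "{f\<in>P. w f \<le> 2 * K}" and ?B = "{f\<in>P. 2 * K < w f}"
  have "P = ?T \<union> ?B" by auto
  then have card: "card P = card ?T + card ?B"
    using assms(1) by (metis (no_types, lifting) card_Un_disjoint finite_Un disjoint_iff mem_Collect_eq not_le)
  have sub: "(\<Sum>f\<in>?B. w f) \<le> (\<Sum>f\<in>P. w f)"
    using assms by (intro sum_mono2) auto
  have "real (card ?B) \<le> real (card ?T)"
  proof (cases "?B = {}")
    case True
    then show ?thesis by (simp only: card.empty of_nat_0 of_nat_0_le_iff)
  next
    case False
    \<comment> \<open>Strictness covers \<open>K = 0\<close>, which occurs for a single key: the
      next inequality then reads 0 < 0, contradicting that \<open>?B\<close> is nonempty.\<close>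
    have "(\<Sum>f\<in>?B. 2 * K) < (\<Sum>f\<in>?B. w f)"
      using False assms(1) by (intro sum_strict_mono) auto
    then have "2 * real (card ?B) * K < real (card P) * K"
      using sub assms(4) by simp
    then have "2 * real (card ?B) < real (card P)"
      using assms(3) by (simp add: mult_less_cancel_right)
    then show ?thesis using card by simp
  qed
  then show ?thesis using card by simp
qed

text \<open>An element of \<open>T\<close> is recovered from the pair \<open>(I f, R f)\<close> and its values outside
  \<open>R f - I f\<close>.\<close>

lemma card_le_by_partial_decoding:
  fixes I R :: "(nat \<Rightarrow> nat) \<Rightarrow> nat set"
  assumes T: "T \<subseteq> PiE {..<n} (\<lambda>_. {..<N})" and N: "1 \<le> N"
    and sub: "\<And>f. f \<in> T \<Longrightarrow> I f \<subseteq> {..<n}" "\<And>f. f \<in> T \<Longrightarrow> R f \<subseteq> {..<n}"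
    and t: "\<And>f. f \<in> T \<Longrightarrow> real (card (I f)) + real n - real (card (R f)) \<le> t"
    and decode: "\<And>f f' i. \<lbrakk>f \<in> T; f' \<in> T; I f = I f'; R f = R f'; \<forall>l\<in>I f. f l = f' l; i \<in> R f\<rbrakk>
                   \<Longrightarrow> f i = f' i"
  shows "real (card T) \<le> 4 ^ n * real N powr t"
proof -
  \<comment> \<open>The pairs \<open>(I f, R f)\<close> take at most \<open>4 ^ n\<close> values, so
    it suffices to bound each fibre \<open>C z\<close> by \<open>N powr t\<close>.\<close>
  let ?Q = "Pow {..<n} \<times> Pow {..<n}"
  define C where "C = (\<lambda>z. {f\<in>T. (I f, R f) = z})"
  have finT: "finite T" using T by (rule finite_subset) (auto intro: finite_PiE)
  have "T = (\<Union>z\<in>?Q. C z)" using sub by (auto simp: C_def)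
  then have "card T \<le> (\<Sum>z\<in>?Q. card (C z))"
    by (metis card_UN_le finite_Pow_iff finite_SigmaI finite_lessThan)
  then have "real (card T) \<le> (\<Sum>z\<in>?Q. real (card (C z)))"
    by (metis of_nat_le_iff of_nat_sum)
  also have "\<dots> \<le> (\<Sum>z\<in>?Q. real N powr t)"
  proof (rule sum_mono)
    fix z assume "z \<in> ?Q"
    show "real (card (C z)) \<le> real N powr t"
    proof (cases "C z = {}")
      case True
      then show ?thesis by simp
    next
      case False
      then obtain f0 where f0: "f0 \<in> T" "(I f0, R f0) = z" by (auto simp: C_def)
      define Y where "Y = I f0 \<union> ({..<n} - R f0)"
      have finY: "finite Y" using sub(1)[OF f0(1)] by (auto simp: Y_def intro: finite_subset)
      have inj: "inj_on (\<lambda>f. restrict f Y) (C z)"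
      proof (rule inj_onI)
        fix f f' assume f: "f \<in> C z" and f': "f' \<in> C z" and eq: "restrict f Y = restrict f' Y"
        have ff: "f \<in> T" "f' \<in> T" "I f = I f0" "R f = R f0" "I f' = I f0" "R f' = R f0"
          using f f' f0 by (auto simp: C_def)
        have Y: "f l = f' l" if "l \<in> Y" for l using eq that by (metis restrict_apply')
        show "f = f'"
        proof (rule PiE_ext[where k = "{..<n}" and s = "\<lambda>_. {..<N}"])
          fix l assume "l \<in> {..<n}"
          show "f l = f' l"
          proof (cases "l \<in> R f")
            case True
            then show ?thesis using decode[of f f' l] ff Y by (auto simp: Y_def)
          next
            case False
            then show ?thesis using Y \<open>l \<in> {..<n}\<close> ff by (auto simp: Y_def)
          qed
        qed (use ff T in auto)
      qed
      have img: "(\<lambda>f. restrict f Y) ` C z \<subseteq> PiE Y (\<lambda>_. {..<N})"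
      proof clarify
        fix f assume "f \<in> C z"
        then have "f \<in> PiE {..<n} (\<lambda>_. {..<N})" using T by (auto simp: C_def)
        moreover have "Y \<subseteq> {..<n}" using sub(1)[OF f0(1)] by (auto simp: Y_def)
        ultimately show "restrict f Y \<in> PiE Y (\<lambda>_. {..<N})" by (auto simp: PiE_iff)
      qed
      have "card (C z) \<le> card (PiE Y (\<lambda>_. {..<N}))"
        by (rule card_inj_on_le[OF inj img]) (use finY in \<open>auto intro: finite_PiE\<close>)
      also have "\<dots> = N ^ card Y" using finY by (simp add: card_PiE)
      finally have "real (card (C z)) \<le> real N ^ card Y"
        by (metis of_nat_le_iff of_nat_power)
      also have "\<dots> = real N powr real (card Y)" using N by (simp add: powr_realpow)
      also have "\<dots> \<le> real N powr t"
      proof (rule powr_mono)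
        have "card Y \<le> card (I f0) + card ({..<n} - R f0)" unfolding Y_def by (rule card_Un_le)
        moreover have "card ({..<n} - R f0) = n - card (R f0)"
          using sub(2)[OF f0(1)] by (simp add: card_Diff_subset finite_subset)
        moreover have "card (R f0) \<le> n"
          using sub(2)[OF f0(1)] by (metis card_lessThan card_mono finite_lessThan)
        ultimately show "real (card Y) \<le> t" using t[OF f0(1)] by linarith
      qed (use N in simp)
      finally show ?thesis .
    qed
  qed
  also have "\<dots> = 4 ^ n * real N powr t"
    by (simp add: card_cartesian_product card_Pow power_mult_distrib[symmetric])
  finally show ?thesis .
qed

section \<open>The hard instances on nearly orthogonal keys\<close>

locale packed_keys =
  fixes dk d m N :: nat and \<rho> :: real and u :: "nat \<Rightarrow> nat \<Rightarrow> real"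
  assumes d_pos: "0 < d" and m_pos: "0 < m" and N_pos: "0 < N" and rho_pos: "0 < \<rho>"
    and key_vecs: "h < m \<Longrightarrow> u h \<in> vecs dk"
    and key_norm: "h < m \<Longrightarrow> nrm dk (u h) = 1"
    and key_ip: "\<lbrakk>h < m; l < m; h \<noteq> l\<rbrakk> \<Longrightarrow> ip dk (u h) (u l) \<le> 1 / \<rho>"
begin

text \<open>List position \<open>h * d + j\<close> holds the key \<open>u h\<close> with a multiple of the basis vector \<open>e\<^sub>j\<close>.\<close>

definition inst :: "(nat \<Rightarrow> nat) \<Rightarrow> ((nat \<Rightarrow> real) \<times> (nat \<Rightarrow> real)) list" where
  "inst f = map (\<lambda>i. (u (i div d), \<lambda>j. if j = i mod d then grid N (f i) else 0)) [0..<m * d]"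

definition query :: "nat \<Rightarrow> nat \<Rightarrow> real" where
  "query h = (\<lambda>i. \<rho> * u h i)"

definition weight :: "nat \<Rightarrow> nat \<Rightarrow> real" where
  "weight h l = exp (ip dk (query h) (u l))"

definition total_weight :: "nat \<Rightarrow> real" where
  "total_weight h = (\<Sum>i<m * d. weight h (i div d))"

text \<open>Besides position \<open>i\<close> itself, only these contribute to coordinate
  \<open>i mod d\<close>. Each belongs to a key other than that of \<open>i\<close>, and each other
  key supplies at most one.\<close>

definition others :: "nat \<Rightarrow> nat set" where
  "others i = {l. l < m * d \<and> l mod d = i mod d \<and> l \<noteq> i}"

definition noise :: "(nat \<Rightarrow> nat) \<Rightarrow> nat \<Rightarrow> real" where
  "noise f i = (\<Sum>l\<in>others i. weight (i div d) (l div d) * grid N (f l))"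

text \<open>The decoder for \<open>grid N (f i)\<close>. It rescales the coreset answer by the total
  weight of the full input, which is known in advance because the keys do not depend on
  \<open>f\<close>.\<close>

definition estimate :: "nat set \<Rightarrow> (nat \<Rightarrow> nat) \<Rightarrow> nat \<Rightarrow> real" where
  "estimate I f i = total_weight (i div d) / exp \<rho> * attn_sub dk (query (i div d)) (inst f) I (i mod d)"

lemma ip_query: "ip dk (query h) x = \<rho> * ip dk (u h) x"
  by (simp add: ip_def query_def sum_distrib_left mult.assoc)

lemma ip_key_self: "h < m \<Longrightarrow> ip dk (u h) (u h) = 1"
  using key_norm[of h] by (simp add: nrm_def)

lemma query_vecs: "h < m \<Longrightarrow> query h \<in> vecs dk"
  using key_vecs[of h] by (simp add: query_def vecs_def)

lemma nrm_query: "h < m \<Longrightarrow> nrm dk (query h) = \<rho>"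
proof -
  assume "h < m"
  have "ip dk (query h) (query h) = \<rho>\<^sup>2 * ip dk (u h) (u h)"
    by (simp add: ip_def query_def sum_distrib_left power2_eq_square algebra_simps)
  then show ?thesis using \<open>h < m\<close> rho_pos by (simp add: nrm_def ip_key_self)
qed

lemma weight_self: "h < m \<Longrightarrow> weight h h = exp \<rho>"
  by (simp add: weight_def ip_query ip_key_self)

lemma weight_le:
  assumes "h < m" "l < m" "h \<noteq> l"
  shows "weight h l \<le> exp 1"
proof -
  have "\<rho> * ip dk (u h) (u l) \<le> \<rho> * (1 / \<rho>)"
    using key_ip[OF assms] rho_pos by (intro mult_left_mono) auto
  then show ?thesis using rho_pos by (simp add: weight_def ip_query)
qed

lemma weight_pos: "0 < weight h l"
  by (simp add: weight_def)

lemma total_weight_pos: "0 < total_weight h"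
  unfolding total_weight_def using d_pos m_pos by (intro sum_pos) (auto simp: weight_pos lessThan_empty_iff)

lemma total_weight_le:
  assumes "h < m"
  shows "total_weight h \<le> real d * (exp \<rho> + exp 1 * (real m - 1))"
proof -
  have "total_weight h = (\<Sum>l<m. \<Sum>j<d. weight h l)"
    unfolding total_weight_def using sum_div_mod[OF d_pos, of "\<lambda>l _. weight h l" m] .
  also have "\<dots> = real d * (\<Sum>l<m. weight h l)"
    by (simp add: sum_distrib_left)
  also have "(\<Sum>l<m. weight h l) = exp \<rho> + (\<Sum>l\<in>{..<m} - {h}. weight h l)"
    using assms by (simp add: sum.remove[of _ h] weight_self)
  also have "(\<Sum>l\<in>{..<m} - {h}. weight h l) \<le> (\<Sum>l\<in>{..<m} - {h}. exp 1)"
    using assms by (intro sum_mono weight_le) auto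
  also have "\<dots> = exp 1 * (real m - 1)"
    using assms by (simp add: of_nat_diff)
  finally show ?thesis using d_pos by (simp add: mult_left_mono)
qed

lemma valid_input_inst:
  assumes "f \<in> PiE {..<m * d} (\<lambda>_. {..<N})"
  shows "valid_input dk d (inst f)"
proof -
  have "nrm d (\<lambda>j. if j = i mod d then grid N (f i) else 0) \<le> 1" if "i < m * d" for i
  proof -
    have "ip d (\<lambda>j. if j = i mod d then grid N (f i) else 0) (\<lambda>j. if j = i mod d then grid N (f i) else 0)
        = (\<Sum>j<d. if j = i mod d then (grid N (f i))\<^sup>2 else 0)"
      unfolding ip_def by (intro sum.cong) (auto simp: power2_eq_square)
    also have "\<dots> = (grid N (f i))\<^sup>2" using d_pos by simp
    finally have "nrm d (\<lambda>j. if j = i mod d then grid N (f i) else 0) = \<bar>grid N (f i)\<bar>"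
      by (simp add: nrm_def)
    moreover have "f i < N" using assms that by auto
    ultimately show ?thesis by (simp add: abs_grid_le_1)
  qed
  moreover have "i mod d < d" for i using d_pos by simp
  ultimately show ?thesis
    unfolding valid_input_def inst_def
    using key_vecs key_norm by (auto simp: vecs_def less_mult_imp_div_less not_less)
      (metis not_le)
qed

lemma length_inst: "length (inst f) = m * d"
  by (simp add: inst_def)

lemma attn_sub_inst:
  assumes "I \<subseteq> {..<m * d}"
  shows "attn_sub dk (query h) (inst f) I j =
      (\<Sum>i\<in>I. weight h (i div d) * (if j = i mod d then grid N (f i) else 0))
        / (\<Sum>i\<in>I. weight h (i div d))"
proof -
  have "inst f ! i = (u (i div d), \<lambda>j. if j = i mod d then grid N (f i) else 0)" if "i \<in> I" for i
  proof -
    have "i < m * d" using subsetD[OF assms that] by simp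
    then have "[0..<m * d] ! i = i" and "i < length [0..<m * d]" by simp_all
    then show ?thesis unfolding inst_def by (simp only: nth_map)
  qed
  then show ?thesis
    unfolding attn_sub_def weight_def by (intro arg_cong2[where f = "(/)"] sum.cong) auto
qed

text \<open>The decoder reads \<open>f\<close> only on \<open>I\<close>. Hence assignments with the
  same coreset positions and the same values there receive identical estimates.\<close>

lemma estimate_cong:
  assumes "I \<subseteq> {..<m * d}" and "\<forall>l\<in>I. f l = f' l"
  shows "estimate I f i = estimate I f' i"
proof -
  have "(\<Sum>l\<in>I. weight h (l div d) * (if j = l mod d then grid N (f l) else 0))
      = (\<Sum>l\<in>I. weight h (l div d) * (if j = l mod d then grid N (f' l) else 0))" for h j
    using assms(2) by (intro sum.cong) auto
  then show ?thesis
    unfolding estimate_def attn_sub_inst[OF assms(1)] by simp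
qed

lemma attn_inst:
  assumes "i < m * d"
  shows "total_weight (i div d) * attn dk (query (i div d)) (inst f) (i mod d)
    = exp \<rho> * grid N (f i) + noise f i"
proof -
  let ?h = "i div d"
  have h: "?h < m" using assms by (simp add: less_mult_imp_div_less)
  have "total_weight ?h * attn dk (query ?h) (inst f) (i mod d)
      = (\<Sum>l<m * d. weight ?h (l div d) * (if i mod d = l mod d then grid N (f l) else 0))"
    using total_weight_pos[of ?h]
    by (simp add: attn_def length_inst attn_sub_inst total_weight_def)
  also have "\<dots> = (\<Sum>l\<in>insert i (others i). weight ?h (l div d) * grid N (f l))"
    by (rule sum.mono_neutral_cong_right) (use assms in \<open>auto simp: others_def\<close>)
  also have "\<dots> = exp \<rho> * grid N (f i) + noise f i"
    by (subst sum.insert) (auto simp: others_def noise_def weight_self h)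
  finally show ?thesis .
qed

text \<open>After multiplication by \<open>exp \<rho>\<close>, the error is the rescaled coreset
  error minus the noise of the exact attention; each contributes at most one
  \<open>\<kappa>\<close>.\<close>

lemma estimate_error:
  assumes "i < m * d" and "\<bar>noise f i\<bar> \<le> \<kappa> * exp \<rho>"
    and "\<bar>attn dk (query (i div d)) (inst f) (i mod d)
          - attn_sub dk (query (i div d)) (inst f) I (i mod d)\<bar> * total_weight (i div d) \<le> \<kappa> * exp \<rho>"
  shows "\<bar>grid N (f i) - estimate I f i\<bar> \<le> 2 * \<kappa>"
proof -
  let ?D = "total_weight (i div d)" and ?L = "exp \<rho>"
  let ?a = "attn dk (query (i div d)) (inst f) (i mod d)"
  let ?b = "attn_sub dk (query (i div d)) (inst f) I (i mod d)"
  have "?L * (grid N (f i) - estimate I f i) = (?a - ?b) * ?D - noise f i"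
    using attn_inst[OF assms(1), of f] by (simp add: estimate_def algebra_simps)
  then have "?L * \<bar>grid N (f i) - estimate I f i\<bar> = \<bar>(?a - ?b) * ?D - noise f i\<bar>"
    by (metis abs_exp_cancel abs_mult)
  also have "\<dots> \<le> \<bar>?a - ?b\<bar> * ?D + \<bar>noise f i\<bar>"
    using total_weight_pos[of "i div d"] abs_triangle_ineq4[of "(?a - ?b) * ?D" "noise f i"]
    by (simp add: abs_mult)
  also have "\<dots> \<le> ?L * (2 * \<kappa>)" using assms(2,3) by (simp only: mult.commute[of ?L] mult.assoc mult_2 distrib_right)
  finally show ?thesis by simp
qed

lemma div_neq_of_others: "l \<in> others i \<Longrightarrow> l div d \<noteq> i div d"
  unfolding others_def by (metis (mono_tags, lifting) div_mult_mod_eq mem_Collect_eq)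

lemma card_others:
  assumes "i < m * d"
  shows "real (card (others i)) \<le> real m - 1"
proof -
  have "card (others i) \<le> card ({..<m} - {i div d})"
  proof (rule card_inj_on_le[where f = "\<lambda>l. l div d"])
    show "inj_on (\<lambda>l. l div d) (others i)"
      by (rule inj_onI) (metis (mono_tags, lifting) div_mult_mod_eq mem_Collect_eq others_def)
    show "(\<lambda>l. l div d) ` others i \<subseteq> {..<m} - {i div d}"
      using div_neq_of_others by (auto simp: others_def less_mult_imp_div_less)
  qed simp
  also have "\<dots> = m - 1" using assms by (simp add: less_mult_imp_div_less)
  finally show ?thesis using m_pos by linarith
qed

section \<open>Positions lost to noise and to coreset error\<close>

lemma noise_second_moment:
  "(\<Sum>f\<in>PiE {..<m * d} (\<lambda>_. {..<N}). \<Sum>i<m * d. (noise f i)\<^sup>2)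
    \<le> real (card (PiE {..<m * d} (\<lambda>_. {..<N}))) * (real (m * d) * ((real m - 1) * (exp 1)\<^sup>2))"
proof -
  let ?P = "PiE {..<m * d} (\<lambda>_. {..<N})"
  have "(\<Sum>f\<in>?P. \<Sum>i<m * d. (noise f i)\<^sup>2) = (\<Sum>i<m * d. \<Sum>f\<in>?P. (noise f i)\<^sup>2)"
    by (rule sum.swap)
  also have "\<dots> \<le> (\<Sum>i<m * d. real (card ?P) * ((real m - 1) * (exp 1)\<^sup>2))"
  proof (rule sum_mono)
    fix i assume i: "i \<in> {..<m * d}"
    have "(\<Sum>f\<in>?P. (noise f i)\<^sup>2) \<le> real (card ?P) * (real (card (others i)) * (exp 1)\<^sup>2)"
      unfolding noise_def
    proof (rule grid_second_moment)
      fix l assume l: "l \<in> others i"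
      have "weight (i div d) (l div d) \<le> exp 1"
        using l i div_neq_of_others[OF l] by (intro weight_le) (auto simp: others_def less_mult_imp_div_less)
      then show "\<bar>weight (i div d) (l div d)\<bar> \<le> exp 1"
        using weight_pos[of "i div d" "l div d"] by simp
    qed (auto simp: others_def)
    also have "\<dots> \<le> real (card ?P) * ((real m - 1) * (exp 1)\<^sup>2)"
      using card_others[of i] i by (intro mult_left_mono mult_right_mono) auto
    finally show "(\<Sum>f\<in>?P. (noise f i)\<^sup>2) \<le> real (card ?P) * ((real m - 1) * (exp 1)\<^sup>2)" .
  qed
  also have "\<dots> = real (card ?P) * (real (m * d) * ((real m - 1) * (exp 1)\<^sup>2))"
    by simp
  finally show ?thesis .
qed

lemma card_noisy_le:
  assumes "0 < \<kappa>" and "(\<Sum>i<m * d. (noise f i)\<^sup>2) \<le> 2 * (real (m * d) * ((real m - 1) * (exp 1)\<^sup>2))"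
    and "2 * (exp 1)\<^sup>2 * (real m - 1) \<le> \<delta> * \<kappa>\<^sup>2 * (exp \<rho>)\<^sup>2"
  shows "real (card {i \<in> {..<m * d}. \<kappa> * exp \<rho> < \<bar>noise f i\<bar>}) \<le> \<delta> * real (m * d)"
proof -
  let ?c = "real (card {i \<in> {..<m * d}. \<kappa> * exp \<rho> < \<bar>noise f i\<bar>})"
  have "?c * (\<kappa> * exp \<rho>)\<^sup>2 \<le> 2 * (real (m * d) * ((real m - 1) * (exp 1)\<^sup>2))"
    by (rule card_exceeding_le) (use assms in auto)
  also have "\<dots> = real (m * d) * (2 * (exp 1)\<^sup>2 * (real m - 1))" by simp
  also have "\<dots> \<le> real (m * d) * (\<delta> * \<kappa>\<^sup>2 * (exp \<rho>)\<^sup>2)"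
    using assms(3) by (rule mult_left_mono) simp
  also have "\<dots> = \<delta> * real (m * d) * (\<kappa> * exp \<rho>)\<^sup>2" by (simp add: power_mult_distrib)
  finally show ?thesis using assms(1) by simp
qed

text \<open>The Euclidean error \<open>\<epsilon>\<close> is shared by \<open>d\<close> coordinates,
  so a typical coordinate has error about \<open>\<epsilon> / sqrt d\<close>. Rescaling by a total
  weight proportional to \<open>d\<close> makes this \<open>\<epsilon> * sqrt d\<close>, the
  quantity in the hypothesis; Chebyshev bounds the exceptions.\<close>

lemma card_inaccurate_le:
  assumes "0 < \<kappa>" and "h < m"
    and good: "nrm d (\<lambda>j. attn dk (query h) (inst f) j - attn_sub dk (query h) (inst f) I j) \<le> \<epsilon>"
    and eps: "\<epsilon>\<^sup>2 * real d * (exp \<rho> + exp 1 * (real m - 1))\<^sup>2 \<le> \<delta> * \<kappa>\<^sup>2 * (exp \<rho>)\<^sup>2"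
  shows "real (card {j \<in> {..<d}. \<kappa> * exp \<rho> < \<bar>attn dk (query h) (inst f) j
          - attn_sub dk (query h) (inst f) I j\<bar> * total_weight h}) \<le> \<delta> * real d"
proof -
  let ?D = "total_weight h"
  let ?z = "\<lambda>j. attn dk (query h) (inst f) j - attn_sub dk (query h) (inst f) I j"
  let ?c = "real (card {j \<in> {..<d}. \<kappa> * exp \<rho> < \<bar>?z j * ?D\<bar>})"
  have "(\<Sum>j<d. (?z j)\<^sup>2) \<le> \<epsilon>\<^sup>2"
    using good sqrt_le_D[of "\<Sum>j<d. (?z j)\<^sup>2" \<epsilon>] by (simp add: nrm_def ip_def power2_eq_square)
  moreover have "?D\<^sup>2 \<le> (real d * (exp \<rho> + exp 1 * (real m - 1)))\<^sup>2"
    using total_weight_le[OF assms(2)] total_weight_pos[of h] by (intro power_mono) auto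
  ultimately have "(\<Sum>j<d. (?z j)\<^sup>2) * ?D\<^sup>2 \<le> \<epsilon>\<^sup>2 * (real d * (exp \<rho> + exp 1 * (real m - 1)))\<^sup>2"
    by (intro mult_mono) auto
  then have "?c * (\<kappa> * exp \<rho>)\<^sup>2 \<le> \<epsilon>\<^sup>2 * (real d * (exp \<rho> + exp 1 * (real m - 1)))\<^sup>2"
    using assms(1) by (intro card_exceeding_le) (auto simp: power_mult_distrib sum_distrib_right)
  also have "\<dots> = real d * (\<epsilon>\<^sup>2 * real d * (exp \<rho> + exp 1 * (real m - 1))\<^sup>2)"
    by (simp add: power2_eq_square ac_simps)
  also have "\<dots> \<le> real d * (\<delta> * \<kappa>\<^sup>2 * (exp \<rho>)\<^sup>2)"
    using eps by (rule mult_left_mono) simp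
  also have "\<dots> = \<delta> * real d * (\<kappa> * exp \<rho>)\<^sup>2" by (simp add: power_mult_distrib)
  finally have "?c \<le> \<delta> * real d" using assms(1) by simp
  then show ?thesis using total_weight_pos[of h] by (simp add: abs_mult)
qed


section \<open>The size bound for a given number of keys\<close>

lemma coreset_size_ge:
  assumes alg: "coreset_alg dk d \<rho> \<epsilon> p S A" and p: "0 < p"
    and N: "16 \<le> real N powr (p / 4)"
    and noise_small: "2 * (exp 1)\<^sup>2 * (real m - 1) \<le> p / 4 * (1 / (4 * real N))\<^sup>2 * (exp \<rho>)\<^sup>2"
    and eps: "\<epsilon>\<^sup>2 * real d * (exp \<rho> + exp 1 * (real m - 1))\<^sup>2
                \<le> p / 4 * (1 / (4 * real N))\<^sup>2 * (exp \<rho>)\<^sup>2"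
  shows "p / 4 * real (m * d) \<le> real S"
proof (rule ccontr)
  assume "\<not> ?thesis"
  then have S: "real S < p / 4 * real (m * d)" by simp
  define n where "n = m * d"
  \<comment> \<open>Noise and coreset error together cost \<open>2 * \<kappa>\<close>, exactly the
    tolerance 1/(2N) of \<open>grid_eqI\<close>.\<close>
  define \<kappa> where "\<kappa> = 1 / (4 * real N)"
  have \<kappa>: "0 < \<kappa>" using N_pos by (simp add: \<kappa>_def)
  have n: "0 < n" using m_pos d_pos by (simp add: n_def)
  define P where "P = PiE {..<n} (\<lambda>_. {..<N})"
  define K where "K = real n * ((real m - 1) * (exp 1)\<^sup>2)"
  \<comment> \<open>Assignments whose total noise is at most twice the average; by Markov they make
    up at least half of \<open>P\<close>.\<close>
  define T where "T = {f\<in>P. (\<Sum>i<n. (noise f i)\<^sup>2) \<le> 2 * K}"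
  define good where "good = (\<lambda>f I h.
      nrm d (\<lambda>j. attn dk (query h) (inst f) j - attn_sub dk (query h) (inst f) I j) \<le> \<epsilon>)"
  have half: "real (card P) \<le> 2 * real (card T)"
    unfolding T_def
  proof (rule half_le_card_below_twice_average)
    show "finite P" by (auto simp: P_def intro: finite_PiE)
    show "0 \<le> K" using m_pos by (simp add: K_def)
    show "(\<Sum>f\<in>P. \<Sum>i<n. (noise f i)\<^sup>2) \<le> real (card P) * K"
      using noise_second_moment by (simp only: P_def K_def n_def)
  qed (auto intro: sum_nonneg)
  \<comment> \<open>The randomness is fixed here: each assignment gets one output good for a
    \<open>p\<close> fraction of the \<open>m\<close> queries.\<close>
  have "\<exists>I. I \<subseteq> {..<n} \<and> card I \<le> S \<and> p * real m \<le> real (card {h\<in>{..<m}. good f I h})"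
    if "f \<in> P" for f
  proof -
    have "valid_input dk d (inst f)" using that by (intro valid_input_inst) (simp add: P_def n_def)
    then have "(\<forall>I\<in>set_pmf (A (inst f)). I \<subseteq> {..<length (inst f)} \<and> card I \<le> S) \<and>
        (\<forall>q\<in>vecs dk. nrm dk q \<le> \<rho> \<longrightarrow> p \<le> measure_pmf.prob (A (inst f))
              {I. nrm d (\<lambda>j. attn dk q (inst f) j - attn_sub dk q (inst f) I j) \<le> \<epsilon>})"
      using alg[unfolded coreset_alg_def, THEN spec, of "inst f"] by (rule rev_mp)
    then have supp: "\<And>I. I \<in> set_pmf (A (inst f)) \<Longrightarrow> I \<subseteq> {..<n} \<and> card I \<le> S"
      and pr: "\<And>q. q \<in> vecs dk \<Longrightarrow> nrm dk q \<le> \<rho> \<Longrightarrow> p \<le> measure_pmf.prob (A (inst f))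
              {I. nrm d (\<lambda>j. attn dk q (inst f) j - attn_sub dk q (inst f) I j) \<le> \<epsilon>}"
      by (simp_all add: length_inst n_def)
    have "finite (set_pmf (A (inst f)))"
      by (rule finite_subset[of _ "Pow {..<n}"]) (use supp in auto)
    then have "\<exists>I\<in>set_pmf (A (inst f)). p * real (card {..<m}) \<le> real (card {h\<in>{..<m}. good f I h})"
      by (rule pmf_exists_outcome_many_events)
         (use pr[OF query_vecs] nrm_query in \<open>auto simp: good_def\<close>)
    then show ?thesis using supp by auto
  qed
  then obtain I where I: "\<And>f. f \<in> P \<Longrightarrow> I f \<subseteq> {..<n}" "\<And>f. f \<in> P \<Longrightarrow> card (I f) \<le> S"
    and I_good: "\<And>f. f \<in> P \<Longrightarrow> p * real m \<le> real (card {h\<in>{..<m}. good f (I f) h})"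
    by metis
  define R where "R = (\<lambda>f. {i\<in>{..<n}. \<bar>grid N (f i) - estimate (I f) f i\<bar> \<le> 2 * \<kappa>})"
  have card_R: "p / 2 * real n \<le> real (card (R f))" if f: "f \<in> T" for f
  proof -
    have fP: "f \<in> P" using f by (simp add: T_def)
    define inacc where "inacc = (\<lambda>h j. \<kappa> * exp \<rho> < \<bar>attn dk (query h) (inst f) j
          - attn_sub dk (query h) (inst f) (I f) j\<bar> * total_weight h)"
    \<comment> \<open>\<open>?X\<close> collects the positions under well-answered queries, at least
      \<open>p * n\<close> of them. Removing at most \<open>p / 4 * n\<close> noisy and
      \<open>p / 4 * n\<close> inaccurate ones leaves \<open>p / 2 * n\<close> positions in
      \<open>R f\<close>.\<close>
    let ?X = "{i. i < m * d \<and> good f (I f) (i div d)}"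
    let ?B1 = "{i \<in> {..<m * d}. \<kappa> * exp \<rho> < \<bar>noise f i\<bar>}"
    let ?B2 = "{i. i < m * d \<and> (good f (I f) (i div d) \<and> inacc (i div d) (i mod d))}"
    have "card ?X = (\<Sum>h<m. card {j. j < d \<and> good f (I f) h})"
      by (rule card_div_mod[OF d_pos, of m "\<lambda>h j. good f (I f) h"])
    also have "\<dots> = (\<Sum>h<m. of_bool (good f (I f) h) * d)"
      by (intro sum.cong) auto
    also have "\<dots> = card {h\<in>{..<m}. good f (I f) h} * d"
      by (simp add: Int_def)
    finally have "real (card ?X) = real (card {h\<in>{..<m}. good f (I f) h}) * real d"
      by simp
    also have "\<dots> \<ge> p * real m * real d"
      using I_good[OF fP] by (intro mult_right_mono) auto
    finally have X: "p * real n \<le> real (card ?X)" by (simp add: n_def mult.assoc)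
    have B1: "real (card ?B1) \<le> p / 4 * real n"
      unfolding n_def
      by (rule card_noisy_le) (use f \<kappa> noise_small in \<open>auto simp: T_def K_def n_def \<kappa>_def\<close>)
    have "real (card ?B2) = (\<Sum>h<m. real (card {j. j < d \<and> (good f (I f) h \<and> inacc h j)}))"
      using card_div_mod[OF d_pos, of m "\<lambda>h j. good f (I f) h \<and> inacc h j"] by simp
    also have "\<dots> \<le> (\<Sum>h<m. p / 4 * real d)"
    proof (rule sum_mono)
      fix h assume h: "h \<in> {..<m}"
      show "real (card {j. j < d \<and> (good f (I f) h \<and> inacc h j)}) \<le> p / 4 * real d"
      proof (cases "good f (I f) h")
        case True
        have "real (card {j \<in> {..<d}. inacc h j}) \<le> p / 4 * real d"
          unfolding inacc_def
          by (rule card_inaccurate_le[of \<kappa> h f "I f" \<epsilon>])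
             (use True h \<kappa> eps in \<open>auto simp: good_def \<kappa>_def\<close>)
        then show ?thesis using True by simp
      next
        case False
        then show ?thesis using p by simp
      qed
    qed
    also have "\<dots> = p / 4 * real n" by (simp add: n_def)
    finally have B2: "real (card ?B2) \<le> p / 4 * real n" .
    have "?X \<subseteq> R f \<union> (?B1 \<union> ?B2)"
    proof
      fix i assume i: "i \<in> ?X"
      show "i \<in> R f \<union> (?B1 \<union> ?B2)"
      proof (cases "i \<in> ?B1 \<union> ?B2")
        case False
        then have "\<bar>grid N (f i) - estimate (I f) f i\<bar> \<le> 2 * \<kappa>"
          using i by (intro estimate_error) (auto simp: inacc_def)
        then show ?thesis using i by (simp add: R_def n_def)
      qed blast
    qed
    then have "card ?X \<le> card (R f \<union> (?B1 \<union> ?B2))"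
      by (rule card_mono[rotated]) (simp add: R_def)
    also have "\<dots> \<le> card (R f) + (card ?B1 + card ?B2)"
      using card_Un_le[of "R f" "?B1 \<union> ?B2"] card_Un_le[of ?B1 ?B2] by linarith
    finally have "real (card ?X) \<le> real (card (R f)) + (real (card ?B1) + real (card ?B2))"
      by linarith
    then show ?thesis using X B1 B2 by simp
  qed
  \<comment> \<open>The exponent comes from \<open>card (I f) < p / 4 * n\<close> and
    \<open>card (R f) \<ge> p / 2 * n\<close>. Decoding works because both grid values lie within
    1/(2N) of one common estimate.\<close>
  have "real (card T) \<le> 4 ^ n * real N powr (real n - p / 4 * real n)"
  proof (rule card_le_by_partial_decoding[where I = I and R = R])
    fix f assume f: "f \<in> T"
    then have "real (card (I f)) \<le> real S" using I(2) by (simp add: T_def)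
    then show "real (card (I f)) + real n - real (card (R f)) \<le> real n - p / 4 * real n"
      using card_R[OF f] S by (simp add: n_def)
  next
    fix f f' i
    assume f: "f \<in> T" "f' \<in> T" "I f = I f'" "R f = R f'" "\<forall>l\<in>I f. f l = f' l" "i \<in> R f"
    have "estimate (I f) f i = estimate (I f) f' i"
      using f I(1)[of f] by (intro estimate_cong) (auto simp: T_def n_def)
    moreover have "i \<in> R f'" using f by simp
    ultimately have "\<bar>grid N (f' i) - estimate (I f) f i\<bar> \<le> 1 / (2 * real N)"
      using f(3) by (simp add: R_def \<kappa>_def)
    moreover have "\<bar>grid N (f i) - estimate (I f) f i\<bar> \<le> 1 / (2 * real N)"
      using f(6) by (simp add: R_def \<kappa>_def)
    ultimately show "f i = f' i" by (intro grid_eqI[OF N_pos])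
  qed (use I N_pos in \<open>auto simp: T_def P_def R_def\<close>)
  also have "\<dots> = 4 ^ n * (real N ^ n / (real N powr (p / 4)) ^ n)"
  proof -
    have "(real N powr (p / 4)) ^ n = (real N powr (p / 4)) powr real n"
      using N_pos by (simp add: powr_realpow)
    also have "\<dots> = real N powr (p / 4 * real n)" by (rule powr_powr)
    finally show ?thesis using N_pos by (simp add: powr_diff powr_realpow)
  qed
  \<comment> \<open>The factor 16 pays for the \<open>4 ^ n\<close> pairs and leaves another
    \<open>4 ^ n\<close>, so \<open>T\<close> falls below the half of \<open>P\<close> that it must
    contain.\<close>
  also have "\<dots> \<le> 4 ^ n * (real N ^ n / 16 ^ n)"
    using N N_pos by (intro mult_left_mono divide_left_mono power_mono) auto
  also have "\<dots> = real N ^ n / 4 ^ n"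
  proof -
    have "(16 :: real) ^ n = 4 ^ n * 4 ^ n" by (simp flip: power_mult_distrib)
    then show ?thesis by simp
  qed
  also have "\<dots> \<le> real N ^ n / 4"
    using n N_pos by (intro divide_left_mono) (auto simp: self_le_power)
  finally have "real (card T) \<le> real N ^ n / 4" .
  moreover have "real (card P) = real N ^ n" by (simp add: P_def card_PiE)
  moreover have "0 < real N ^ n" using N_pos by simp
  ultimately show False using half by linarith
qed

end


section \<open>Choice of the constants, depending on \<open>p\<close> only, and of the number of
  keys\<close>

theorem theorem11:
  fixes a :: real and p :: real
  assumes "packing_const a"
    and "0 < p" and "p \<le> 1"
  shows "\<exists>\<epsilon>\<^sub>0 > 0. \<exists>c > 0. \<forall>(d::nat) (dk::nat) (\<rho>::real) (\<epsilon>::real) (S::nat) A.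
           d > 1 \<longrightarrow> dk > 1 \<longrightarrow> \<rho> \<ge> 2 \<longrightarrow> 0 < \<epsilon> \<longrightarrow> \<epsilon> \<le> \<epsilon>\<^sub>0 / sqrt (real d) \<longrightarrow>
           coreset_alg dk d \<rho> \<epsilon> p S A \<longrightarrow>
           (let L = exp \<rho> in
              real S \<ge> c * real d * min (L / (\<epsilon> * sqrt (real d)))
                                        (min (L^2) (exp (a * real dk / (ln L)^2))))"
proof -
  define N where "N = nat \<lceil>16 powr (4 / p)\<rceil>"
  have N_ge: "16 powr (4 / p) \<le> real N" unfolding N_def by linarith
  moreover have "0 < 16 powr (4 / p)" by simp
  ultimately have N_pos: "0 < N" by linarith
  have N: "16 \<le> real N powr (p / 4)"
  proof -
    have "16 = (16 powr (4 / p)) powr (p / 4)" using assms(2) by (simp add: powr_powr)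
    also have "\<dots> \<le> real N powr (p / 4)" using N_ge assms(2) by (intro powr_mono2) auto
    finally show ?thesis .
  qed
  \<comment> \<open>Chosen so that \<open>s\<^sup>2\<close> is the constant on the right of both
    smallness conditions of \<open>coreset_size_ge\<close>.\<close>
  define s where "s = sqrt (p / 4) * (1 / (4 * real N))"
  have s: "0 < s" using N_pos assms(2) by (simp add: s_def)
  have s2: "s\<^sup>2 = p / 4 * (1 / (4 * real N))\<^sup>2"
    using assms(2) by (simp add: s_def power_mult_distrib power_divide)
  \<comment> \<open>The three bounds serve, in order, the packing limit on \<open>m\<close>, the
    noise condition and the accuracy condition.\<close>
  define c where "c = min (1 / 2) (min (s\<^sup>2 / (2 * (exp 1)\<^sup>2)) (s / (2 * exp 1)))"
  have c: "0 < c" "c \<le> 1 / 2" "2 * (exp 1)\<^sup>2 * c \<le> s\<^sup>2" "exp 1 * c \<le> s / 2"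
  proof -
    show "0 < c" "c \<le> 1 / 2" using s by (auto simp: c_def)
    have "c \<le> s\<^sup>2 / (2 * (exp 1)\<^sup>2)" "c \<le> s / (2 * exp 1)" by (auto simp: c_def)
    then show "2 * (exp 1)\<^sup>2 * c \<le> s\<^sup>2" "exp 1 * c \<le> s / 2" by (simp_all add: field_simps)
  qed
  have bound: "p / 4 * c * real d * min (exp \<rho> / (\<epsilon> * sqrt (real d)))
                       (min ((exp \<rho>)\<^sup>2) (exp (a * real dk / \<rho>\<^sup>2))) \<le> real S"
    if d: "1 < d" and dk: "1 < dk" and \<rho>: "2 \<le> \<rho>" and \<epsilon>: "0 < \<epsilon>" "\<epsilon> \<le> s / 2 / sqrt (real d)"
      and alg: "coreset_alg dk d \<rho> \<epsilon> p S A"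
    for d dk :: nat and \<rho> \<epsilon> :: real and S :: nat and A
  proof -
    let ?L = "exp \<rho>" and ?E = "exp (a * real dk / \<rho>\<^sup>2)" and ?t = "\<epsilon> * sqrt (real d)"
    define M where "M = min (?L / ?t) (min (?L\<^sup>2) ?E)"
    \<comment> \<open>Adding one to the floor gives \<open>c * M \<le> m\<close> and at least one
      key, while \<open>m - 1\<close>, which enters the smallness conditions, stays at most
      \<open>c * M\<close>.\<close>
    define m where "m = Suc (nat \<lfloor>c * M\<rfloor>)"
    have t: "0 < ?t" "?t \<le> s / 2" using \<epsilon> d by (simp_all add: field_simps)
    have M: "0 < M" "M \<le> ?L / ?t" "M \<le> ?L\<^sup>2" "M \<le> ?E" using t by (auto simp: M_def)
    have cM: "0 < c * M" using c M by simp
    have m: "real m - 1 \<le> c * M" "c * M \<le> real m" unfolding m_def using cM by linarith+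
    have "0 < a" using assms(1) by (simp add: packing_const_def)
    \<comment> \<open>For \<open>c * M < 1\<close> there is one key and \<open>?E\<close> is at
      least 1; otherwise \<open>m \<le> c * M + 1 \<le> 2 * c * M \<le> M\<close>.\<close>
    have "real m \<le> ?E"
    proof (cases "c * M < 1")
      case True
      then have "m = 1" using cM by (simp add: m_def floor_eq_iff)
      then show ?thesis using \<open>0 < a\<close> by simp
    next
      case False
      then have "real m \<le> 2 * c * M" using m by simp
      also have "\<dots> \<le> 1 * M" using c M by (intro mult_right_mono) auto
      finally show ?thesis using M by simp
    qed
    then have "real m \<le> exp (a * (1 / \<rho>)\<^sup>2 * real dk)" by (simp add: power_divide)
    moreover have "0 < 1 / \<rho>" "1 / \<rho> \<le> 1 / 2" using \<rho> by (simp_all add: field_simps)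
    ultimately obtain u where u: "\<forall>i<m. u i \<in> vecs dk \<and> nrm dk (u i) = 1"
        "\<forall>i<m. \<forall>h<m. i \<noteq> h \<longrightarrow> ip dk (u i) (u h) \<le> 1 / \<rho>"
      using assms(1) dk unfolding packing_const_def by (metis less_imp_le)
    interpret packed_keys dk d m N \<rho> u
      by unfold_locales (use u d N_pos \<rho> in \<open>auto simp: m_def\<close>)
    have S: "p / 4 * real (m * d) \<le> real S"
    proof (rule coreset_size_ge[OF alg assms(2) N])
      have "2 * (exp 1)\<^sup>2 * (real m - 1) \<le> 2 * (exp 1)\<^sup>2 * (c * M)"
        using m(1) by (intro mult_left_mono) auto
      also have "\<dots> = 2 * (exp 1)\<^sup>2 * c * M" by simp
      also have "\<dots> \<le> s\<^sup>2 * ?L\<^sup>2" using c M by (intro mult_mono) auto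
      finally show "2 * (exp 1)\<^sup>2 * (real m - 1) \<le> p / 4 * (1 / (4 * real N))\<^sup>2 * ?L\<^sup>2"
        by (simp only: s2)
      \<comment> \<open>The budget \<open>s * ?L\<close> is split evenly: the foreign keys use one
        half through \<open>M \<le> ?L / ?t\<close>, the queried key the other through
        \<open>?t \<le> s / 2\<close>.\<close>
      have "?t * (exp 1 * (real m - 1)) \<le> ?t * (exp 1 * (c * (?L / ?t)))"
      proof -
        have "c * M \<le> c * (?L / ?t)" using M c by (intro mult_left_mono) auto
        then show ?thesis using m(1) t by (intro mult_left_mono) auto
      qed
      also have "\<dots> = exp 1 * c * ?L" using \<epsilon>(1) d by simp
      also have "\<dots> \<le> s / 2 * ?L" using c by (intro mult_right_mono) auto
      finally have 1: "?t * (exp 1 * (real m - 1)) \<le> s / 2 * ?L" .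
      have 2: "?t * ?L \<le> s / 2 * ?L" using t by (intro mult_right_mono) auto
      have "?t * (?L + exp 1 * (real m - 1)) \<le> s * ?L"
        using 1 2 by (simp only: distrib_left)
      then have "(?t * (?L + exp 1 * (real m - 1)))\<^sup>2 \<le> (s * ?L)\<^sup>2"
        using \<epsilon>(1) m_pos by (intro power_mono mult_nonneg_nonneg add_nonneg_nonneg) auto
      then show "\<epsilon>\<^sup>2 * real d * (?L + exp 1 * (real m - 1))\<^sup>2 \<le> p / 4 * (1 / (4 * real N))\<^sup>2 * ?L\<^sup>2"
        by (simp only: power_mult_distrib s2 real_sqrt_pow2 of_nat_0_le_iff)
    qed
    have "p / 4 * c * real d * M = p / 4 * (real d * (c * M))" by simp
    also have "\<dots> \<le> p / 4 * (real d * real m)"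
      using m assms(2) by (intro mult_left_mono) auto
    also have "\<dots> \<le> real S" using S by (simp add: mult.commute)
    finally show ?thesis by (simp only: M_def)
  qed
  have "0 < s / 2" "0 < p / 4 * c" using s c assms(2) by auto
  moreover have "let L = exp \<rho> in p / 4 * c * real d * min (L / (\<epsilon> * sqrt (real d)))
                  (min (L\<^sup>2) (exp (a * real dk / (ln L)\<^sup>2))) \<le> real S"
    if "1 < d" "1 < dk" "2 \<le> \<rho>" "0 < \<epsilon>" "\<epsilon> \<le> s / 2 / sqrt (real d)" "coreset_alg dk d \<rho> \<epsilon> p S A"
    for d dk S :: nat and \<rho> \<epsilon> :: real and A
    using that unfolding Let_def ln_exp by (rule bound)
  ultimately show ?thesis by blast
qed

end
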